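(* Let $G=(V,E)$ be a graph and $f:V\to\{0,1,2\}$. Then $f$ is a minimal maximal Roman dominating function on $G$ if and only if all of the following hold: (1) $f$ is a maximal Roman dominating function; (2) for all $v\in V_1(f)$, $N(v)\cap V_2(f)=\emptyset$ or $V\setminus N[V_0(f)]\subseteq N[v]$; (3) for all $v\in V_2(f)$, $P_{G[V_0(f)\cup V_2(f)],V_2(f)}(v)\not\subseteq\{v\}$.
   Context: Graphs are finite, simple and undirected. $N(v)$ is the open neighborhood, $N[v]=N(v)\cup\{v\}$, $N[A]=\bigcup_{v\in A}N[v]$. For a graph $H$, $A\subseteq V(H)$ and $v\in A$, the private neighborhood is $P_{H,A}(v)=N_H[v]\setminus N_H[A\setminus\{v\}]$. For $f:V\to\{0,1,2\}$, $V_i(f)=\{v: f(v)=i\}$; $f\le g$ is pointwise. A maximal Roman dominating function (mRdf) on $G$ is an $f:V\to\{0,1,2\}$ such that $N(v)\cap V_2(f)\ne\emptyset$ for every $v\in V_0(f)$ and $N[V_0(f)]\ne V$ (i.e. $V_0(f)$ is not a dominating set). It is minimal if no mRdf $g\le f$ with $g\ne f$ exists. *)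

theory Defs
  imports "Graph_Theory.Graph_Theory" "HOL-Library.FuncSet"
begin

text \<open>
  The locale \<^locale>\<open>graph\<close> is that of finite, loop-free, symmetric digraphs without multiple arcs,
  i.e.\ of finite simple undirected graphs (each edge being a pair of opposite arcs).
  The induced subgraph is \<^const>\<open>induce_subgraph\<close>, written with infix \<open>\<restriction>\<close>.
\<close>

definition open_nbhd :: "('a, 'b) pre_digraph \<Rightarrow> 'a \<Rightarrow> 'a set" where
  "open_nbhd G v = {u. v \<rightarrow>\<^bsub>G\<^esub> u}"

definition closed_nbhd :: "('a, 'b) pre_digraph \<Rightarrow> 'a \<Rightarrow> 'a set" where
  "closed_nbhd G v = open_nbhd G v \<union> {v}"

definition closed_nbhd_set :: "('a, 'b) pre_digraph \<Rightarrow> 'a set \<Rightarrow> 'a set" where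
  "closed_nbhd_set G A = (\<Union>v\<in>A. closed_nbhd G v)"

definition private_nbhd :: "('a, 'b) pre_digraph \<Rightarrow> 'a set \<Rightarrow> 'a \<Rightarrow> 'a set" where
  "private_nbhd H A v = closed_nbhd H v - closed_nbhd_set H (A - {v})"

definition level_set :: "('a, 'b) pre_digraph \<Rightarrow> ('a \<Rightarrow> nat) \<Rightarrow> nat \<Rightarrow> 'a set" where
  "level_set G f i = {v \<in> verts G. f v = i}"

text \<open>
  Functions \<open>V \<rightarrow> {0,1,2}\<close> are taken from the extensional function space, so that equality of such
  functions is equality on \<open>V\<close>. "Maximal" is part of the name of the notion and does not refer to
  the pointwise order.
\<close>

definition maximal_Roman_dominating :: "('a, 'b) pre_digraph \<Rightarrow> ('a \<Rightarrow> nat) \<Rightarrow> bool" where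
  "maximal_Roman_dominating G f \<longleftrightarrow>
     f \<in> verts G \<rightarrow>\<^sub>E {0, 1, 2} \<and>
     (\<forall>v \<in> level_set G f 0. open_nbhd G v \<inter> level_set G f 2 \<noteq> {}) \<and>
     closed_nbhd_set G (level_set G f 0) \<noteq> verts G"

definition minimal_maximal_Roman_dominating ::
    "('a, 'b) pre_digraph \<Rightarrow> ('a \<Rightarrow> nat) \<Rightarrow> bool" where
  "minimal_maximal_Roman_dominating G f \<longleftrightarrow>
     maximal_Roman_dominating G f \<and>
     \<not> (\<exists>g. maximal_Roman_dominating G g \<and> (\<forall>v \<in> verts G. g v \<le> f v) \<and> g \<noteq> f)"

end

theory Submission
  imports Defs
begin

text \<open>
  A vertex of value 2 can be lowered to 1 exactly if no vertex of value 0 depends on it alone, and a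
  vertex of value 1 can be lowered to 0 exactly if it has a neighbour of value 2 and does not
  complete the vertices of value 0 to a dominating set. Conversely, for \<open>g \<le> f\<close> the
  private neighbours first force \<open>g\<close> to keep all values 2, so \<open>g\<close> lowers some value
  1 to 0, which condition (2) forbids.
\<close>

lemma open_nbhd_induce_subgraph:
  "open_nbhd (G \<restriction> S) v = (if v \<in> S then open_nbhd G v \<inter> S else {})"
  by (force simp: open_nbhd_def induce_subgraph_def arcs_ends_def arc_to_ends_def)

lemma open_nbhd_commute:
  assumes "graph G"
  shows "u \<in> open_nbhd G v \<longleftrightarrow> v \<in> open_nbhd G u"
proof -
  interpret graph G by fact
  show ?thesis
    using arcs_ends_symmetric[OF sym_arcs] unfolding open_nbhd_def mem_Collect_eq by metis
qed

lemma closed_nbhd_subset_verts: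
  assumes "graph G" "v \<in> verts G"
  shows "closed_nbhd G v \<subseteq> verts G"
proof -
  interpret graph G by fact
  show ?thesis
    using assms(2) by (auto simp: closed_nbhd_def open_nbhd_def)
qed

lemma closed_nbhd_set_subset_verts:
  assumes "graph G" "A \<subseteq> verts G"
  shows "closed_nbhd_set G A \<subseteq> verts G"
  using closed_nbhd_subset_verts[OF assms(1)] assms(2) by (fastforce simp: closed_nbhd_set_def)

lemma level_set_subset_verts: "level_set G f i \<subseteq> verts G"
  by (auto simp: level_set_def)

text \<open>A vertex lies in its own closed neighbourhood, so a private neighbour of
  \<open>v\<close> other than \<open>v\<close> cannot have value 2 and must have value 0. Passing to
  the induced subgraph loses no adjacency here, as both ends have value 0 or 2. This turns condition
  (3) into a statement about neighbourhoods in \<open>G\<close> alone.\<close>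

lemma private_nbhd_level_sets_not_subset_iff:
  assumes "graph G" "v \<in> level_set G f 2"
  shows "\<not> private_nbhd (G \<restriction> (level_set G f 0 \<union> level_set G f 2)) (level_set G f 2) v \<subseteq> {v}
    \<longleftrightarrow> (\<exists>u \<in> level_set G f 0. open_nbhd G u \<inter> level_set G f 2 = {v})"
    (is "?L \<longleftrightarrow> ?R")
proof -
  have disj: "level_set G f 0 \<inter> level_set G f 2 = {}"
    by (auto simp: level_set_def)
  have "?L \<longleftrightarrow> (\<exists>u \<in> level_set G f 0. u \<in> open_nbhd G v \<and>
      (\<forall>w \<in> level_set G f 2 - {v}. u \<notin> open_nbhd G w))"
    using assms(2) disj
    by (auto simp: private_nbhd_def closed_nbhd_set_def closed_nbhd_def open_nbhd_induce_subgraph)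
  also have "\<dots> \<longleftrightarrow> ?R"
  proof (intro bex_cong refl)
    fix u
    \<comment> \<open>Adjacency is symmetric, so the vertices \<open>w\<close> that have
      \<open>u\<close> as a neighbour are exactly the neighbours of \<open>u\<close>.\<close>
    have "open_nbhd G u = {w. u \<in> open_nbhd G w}"
      by (simp add: set_eq_iff open_nbhd_commute[OF assms(1), of u])
    then show "u \<in> open_nbhd G v \<and> (\<forall>w \<in> level_set G f 2 - {v}. u \<notin> open_nbhd G w) \<longleftrightarrow>
        open_nbhd G u \<inter> level_set G f 2 = {v}"
      using assms(2) by auto
  qed
  finally show ?thesis .
qed

lemma maximal_Roman_dominating_lower_one:
  assumes f: "maximal_Roman_dominating G f"
    and v: "v \<in> level_set G f 1"
    and nbr: "open_nbhd G v \<inter> level_set G f 2 \<noteq> {}"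
    and dom: "\<not> verts G - closed_nbhd_set G (level_set G f 0) \<subseteq> closed_nbhd G v"
  shows "maximal_Roman_dominating G (f(v := 0))"
proof -
  have lev: "level_set G (f(v := 0)) 0 = insert v (level_set G f 0)"
    "level_set G (f(v := 0)) 2 = level_set G f 2"
    using v by (auto simp: level_set_def)
  \<comment> \<open>\<open>dom\<close> provides a vertex outside both N[V_0(f)] and N[v]; it remains
    undominated once \<open>v\<close> joins the vertices of value 0.\<close>
  have "closed_nbhd_set G (insert v (level_set G f 0)) \<noteq> verts G"
    using dom by (auto simp: closed_nbhd_set_def)
  moreover have "f(v := 0) \<in> verts G \<rightarrow>\<^sub>E {0, 1, 2}"
    using f v by (auto simp: maximal_Roman_dominating_def level_set_def PiE_iff extensional_def)
  ultimately show ?thesis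
    using f nbr unfolding maximal_Roman_dominating_def lev by blast
qed

text \<open>The vertices of value 0 stay the same, so they still fail to dominate. The only danger
  is a vertex of value 0 that loses its last neighbour of value 2, and \<open>priv\<close> excludes
  this.\<close>

lemma maximal_Roman_dominating_lower_two:
  assumes f: "maximal_Roman_dominating G f"
    and v: "v \<in> level_set G f 2"
    and priv: "\<not> (\<exists>u \<in> level_set G f 0. open_nbhd G u \<inter> level_set G f 2 = {v})"
  shows "maximal_Roman_dominating G (f(v := 1))"
proof -
  have lev: "level_set G (f(v := 1)) 0 = level_set G f 0"
    "level_set G (f(v := 1)) 2 = level_set G f 2 - {v}"
    using v by (auto simp: level_set_def)
  have "f(v := 1) \<in> verts G \<rightarrow>\<^sub>E {0, 1, 2}"
    using f v by (auto simp: maximal_Roman_dominating_def level_set_def PiE_iff extensional_def)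
  moreover have "open_nbhd G u \<inter> (level_set G f 2 - {v}) \<noteq> {}" if "u \<in> level_set G f 0" for u
  proof -
    have "open_nbhd G u \<inter> level_set G f 2 \<noteq> {}"
      using f that by (auto simp: maximal_Roman_dominating_def)
    with priv that show ?thesis by blast
  qed
  ultimately show ?thesis
    using f unfolding maximal_Roman_dominating_def lev by blast
qed

lemma maximal_Roman_dominating_le_imp_eq:
  assumes G: "graph G" and f: "f \<in> verts G \<rightarrow>\<^sub>E {0, 1, 2}"
    and g: "maximal_Roman_dominating G g" and le: "\<forall>v \<in> verts G. g v \<le> f v"
    and one: "\<And>v. v \<in> level_set G f 1 \<Longrightarrow> open_nbhd G v \<inter> level_set G f 2 = {} \<or>
       verts G - closed_nbhd_set G (level_set G f 0) \<subseteq> closed_nbhd G v"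
    and two: "\<And>v. v \<in> level_set G f 2 \<Longrightarrow>
       \<exists>u \<in> level_set G f 0. open_nbhd G u \<inter> level_set G f 2 = {v}"
  shows "g = f"
proof (rule PiE_ext)
  show g_PiE: "g \<in> verts G \<rightarrow>\<^sub>E {0, 1, 2}"
    using g by (simp add: maximal_Roman_dominating_def)
  show "f \<in> verts G \<rightarrow>\<^sub>E {0, 1, 2}" by (fact f)
  have val: "f x \<in> {0, 1, 2}" "g x \<in> {0, 1, 2}" if "x \<in> verts G" for x
    using PiE_mem[OF f that] PiE_mem[OF g_PiE that] by simp_all
  have zero: "level_set G f 0 \<subseteq> level_set G g 0"
    using le by (auto simp: level_set_def)
  \<comment> \<open>Since 2 is the largest value of \<open>f\<close>, \<open>g x = 2\<close> forces
    \<open>f x = 2\<close>.\<close>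
  have "level_set G g 2 \<subseteq> level_set G f 2"
    using le val by (fastforce simp: level_set_def)
  then have nbr: "open_nbhd G x \<inter> level_set G g 2 \<noteq> {}"
      "open_nbhd G x \<inter> level_set G g 2 \<subseteq> open_nbhd G x \<inter> level_set G f 2"
    if "x \<in> level_set G g 0" for x
    using g that by (auto simp: maximal_Roman_dominating_def)
  fix v assume v: "v \<in> verts G"
  show "g v = f v"
  proof (rule ccontr)
    assume "g v \<noteq> f v"
    then have less: "g v < f v" using le v by fastforce
    then consider "v \<in> level_set G f 2" | "v \<in> level_set G f 1" "v \<in> level_set G g 0"
      using val[OF v] v by (auto simp: level_set_def)
    then show False
    proof cases
      case 1
      then obtain u where u: "u \<in> level_set G f 0" "open_nbhd G u \<inter> level_set G f 2 = {v}"
        using two by blast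
      then have "u \<in> level_set G g 0"
        using zero by blast
      \<comment> \<open>Under \<open>g\<close> the vertex \<open>u\<close> still needs a neighbour
        of value 2, and \<open>v\<close> is the only candidate.\<close>
      from nbr[OF this] u(2) have "v \<in> level_set G g 2"
        by auto
      with 1 less show False by (simp add: level_set_def)
    next
      case 2
      \<comment> \<open>As \<open>g v = 0\<close>, \<open>v\<close> has a neighbour of value 2 under
        \<open>g\<close>, hence under \<open>f\<close>, which rules out the first alternative of
        \<open>one\<close>.\<close>
      then have "verts G - closed_nbhd_set G (level_set G f 0) \<subseteq> closed_nbhd G v"
        using one[OF 2(1)] nbr[OF 2(2)] by auto
      \<comment> \<open>The zeros of \<open>g\<close> include those of \<open>f\<close> and also
        \<open>v\<close>, whose closed neighbourhood covers all that the zeros of \<open>f\<close>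
        miss.\<close>
      then have "verts G \<subseteq> closed_nbhd_set G (level_set G g 0)"
        using zero 2(2) by (fastforce simp: closed_nbhd_set_def)
      then show False
        using g closed_nbhd_set_subset_verts[OF G level_set_subset_verts]
        by (auto simp: maximal_Roman_dominating_def)
    qed
  qed
qed

theorem theorem2:
  fixes G :: "('a, 'b) pre_digraph" and f :: "'a \<Rightarrow> nat"
  assumes "graph G"
    and "f \<in> verts G \<rightarrow>\<^sub>E {0, 1, 2}"
  shows "minimal_maximal_Roman_dominating G f \<longleftrightarrow>
    maximal_Roman_dominating G f \<and>
    (\<forall>v \<in> level_set G f 1.
       open_nbhd G v \<inter> level_set G f 2 = {} \<or>
       verts G - closed_nbhd_set G (level_set G f 0) \<subseteq> closed_nbhd G v) \<and>
    (\<forall>v \<in> level_set G f 2.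
       \<not> private_nbhd (G \<restriction> (level_set G f 0 \<union> level_set G f 2)) (level_set G f 2) v \<subseteq> {v})"
    (is "?M \<longleftrightarrow> ?R \<and> ?one \<and> ?two")
proof
  assume M: ?M
  then have f: ?R
    by (simp add: minimal_maximal_Roman_dominating_def)
  have no_lower: "\<not> maximal_Roman_dominating G (f(v := k))" if "k < f v" for v k
  proof
    assume "maximal_Roman_dominating G (f(v := k))"
    moreover have "\<forall>x \<in> verts G. (f(v := k)) x \<le> f x" "f(v := k) \<noteq> f"
      using that by (auto simp: fun_eq_iff)
    ultimately show False
      using M unfolding minimal_maximal_Roman_dominating_def by blast
  qed
  \<comment> \<open>A vertex of value 1 violating condition (2) could be lowered to 0, contradicting
    minimality.\<close>
  have ?one
    using maximal_Roman_dominating_lower_one[OF f] no_lower[of 0]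
    by (fastforce simp: level_set_def)
  moreover have ?two
  proof
    fix v assume v: "v \<in> level_set G f 2"
    then have "\<not> maximal_Roman_dominating G (f(v := 1))"
      by (intro no_lower) (simp add: level_set_def)
    then have "\<exists>u \<in> level_set G f 0. open_nbhd G u \<inter> level_set G f 2 = {v}"
      using maximal_Roman_dominating_lower_two[OF f v] by blast
    then show "\<not> private_nbhd (G \<restriction> (level_set G f 0 \<union> level_set G f 2)) (level_set G f 2) v \<subseteq> {v}"
      using private_nbhd_level_sets_not_subset_iff[OF assms(1) v] by blast
  qed
  ultimately show "?R \<and> ?one \<and> ?two" using f by blast
next
  assume R: "?R \<and> ?one \<and> ?two"
  have "g = f" if "maximal_Roman_dominating G g" "\<forall>v \<in> verts G. g v \<le> f v" for g
  proof (rule maximal_Roman_dominating_le_imp_eq[OF assms that])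
    fix v assume "v \<in> level_set G f 1"
    then show "open_nbhd G v \<inter> level_set G f 2 = {} \<or>
       verts G - closed_nbhd_set G (level_set G f 0) \<subseteq> closed_nbhd G v"
      using R by blast
  next
    fix v assume "v \<in> level_set G f 2"
    then show "\<exists>u \<in> level_set G f 0. open_nbhd G u \<inter> level_set G f 2 = {v}"
      using R private_nbhd_level_sets_not_subset_iff[OF assms(1)] by blast
  qed
  then show ?M
    using R unfolding minimal_maximal_Roman_dominating_def by blast
qed

end
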